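(* (i) Let $k\geq 3$ and let $G$ be a graph with $m^{\ast}(G)=k-1$ and girth at least $2k+2$. If $G$ contains the tree $R_k$ as a (not necessarily induced) subgraph, then $z(G)=k$. (ii) Let $k\geq 3$ and let $G$ be a graph on at least $(k-3)2^{k-1}+k+2$ vertices such that $m^{\ast}(G)=\delta(G)=k-1$ and the girth of $G$ is at least $2k+2$. Then $z(G)=k$.
   Context: All graphs are finite, nonempty, undirected, without loops or multiple edges. The girth of a graph is the length of its shortest cycle (an acyclic graph has girth $\infty$); $\delta(G)$ is the minimum degree. A proper vertex coloring of $G$ with $k$ colors is a surjective map $c:V(G)\to\{1,\dots,k\}$ with $c(x)\neq c(y)$ for every edge $xy$. In such a coloring, a vertex $v$ is a b-vertex if for every color $j\neq c(v)$ in $\{1,\dots,k\}$, $v$ has a neighbor of color $j$. A vertex $u$ is nice if for every color $j\neq c(u)$, $u$ has a neighbor of color $j$ that is a b-vertex. A Grundy coloring with $k$ colors is a proper coloring with $k$ colors such that for all $i<j$ in $\{1,\dots,k\}$, every vertex of color $j$ has a neighbor of color $i$. A $z$-coloring with $k$ colors is a Grundy coloring with $k$ colors that has a nice vertex of color $k$. $z(G)$ is the maximum number of colors in a $z$-coloring of $G$. $m^{\ast}(G)$ is the largest integer $k\ge 0$ such that some vertex of degree at least $k$ in $G$ has at least $k$ neighbors each of degree at least $k$ in $G$. For $k\ge 3$, $R_k$ is the unique (up to isomorphism) tree with the smallest number of vertices among trees $T$ with $z(T)=k$; it has $(k-3)2^{k-1}+k+2$ vertices. Explicitly, it is the following rooted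 tree, described together with its canonical $z$-coloring with $k$ colors. The root $u$ has color $k$ and exactly $k-1$ children $w_1,\dots,w_{k-1}$, where $w_i$ has color $i$. Each $w_i$ has exactly $k-2$ children, one of each color in $\{1,\dots,k-1\}\setminus\{i\}$. A child of $w_i$ of color $j$ has exactly one child of each color in $\{1,\dots,j-1\}\setminus\{i\}$ and no other children. Every vertex at distance at least $3$ from the root, of color $j$, has exactly $j-1$ children, one of each color in $\{1,\dots,j-1\}$. *)

theory Defs
  imports "Graph_Theory.Graph_Theory" "HOL-Library.Extended_Nat"
begin

text \<open>
  A simple graph is a \<^locale>\<open>pair_graph\<close>: a finite, loop-free digraph whose arc relation
  is symmetric, so that every undirected edge is represented by its two orientations. In
  particular, the neighbours of \<open>v\<close> are \<open>parcs G `` {v}\<close>.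
\<close>

abbreviation degree :: "'a pair_pre_digraph \<Rightarrow> 'a \<Rightarrow> nat" where
  "degree G v \<equiv> out_degree (with_proj G) v"

definition min_degree :: "'a pair_pre_digraph \<Rightarrow> nat" where
  "min_degree G = Min (degree G ` pverts G)"

text \<open>
  The library's \<^const>\<open>pre_digraph.cycle\<close> also accepts walking along an edge and straight
  back; the cycles of length at least 3 are exactly the cycles of the undirected graph. The
  infimum of the empty set is \<open>\<infinity>\<close>.
\<close>

definition girth :: "'a pair_pre_digraph \<Rightarrow> enat" where
  "girth G = (INF p \<in> {p. pre_digraph.cycle (with_proj G) p \<and> 3 \<le> length p}. enat (length p))"

definition proper_coloring :: "'a pair_pre_digraph \<Rightarrow> nat \<Rightarrow> ('a \<Rightarrow> nat) \<Rightarrow> bool" where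
  "proper_coloring G k c \<longleftrightarrow>
     c ` pverts G = {1..k} \<and> (\<forall>(x, y) \<in> parcs G. c x \<noteq> c y)"

definition b_vertex :: "'a pair_pre_digraph \<Rightarrow> nat \<Rightarrow> ('a \<Rightarrow> nat) \<Rightarrow> 'a \<Rightarrow> bool" where
  "b_vertex G k c v \<longleftrightarrow>
     v \<in> pverts G \<and> (\<forall>j \<in> {1..k} - {c v}. \<exists>w. (v, w) \<in> parcs G \<and> c w = j)"

definition nice_vertex :: "'a pair_pre_digraph \<Rightarrow> nat \<Rightarrow> ('a \<Rightarrow> nat) \<Rightarrow> 'a \<Rightarrow> bool" where
  "nice_vertex G k c u \<longleftrightarrow>
     u \<in> pverts G \<and>
     (\<forall>j \<in> {1..k} - {c u}. \<exists>w. (u, w) \<in> parcs G \<and> c w = j \<and> b_vertex G k c w)"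

definition grundy_coloring :: "'a pair_pre_digraph \<Rightarrow> nat \<Rightarrow> ('a \<Rightarrow> nat) \<Rightarrow> bool" where
  "grundy_coloring G k c \<longleftrightarrow>
     proper_coloring G k c \<and>
     (\<forall>i \<in> {1..k}. \<forall>j \<in> {1..k}. i < j \<longrightarrow>
        (\<forall>v \<in> pverts G. c v = j \<longrightarrow> (\<exists>w. (v, w) \<in> parcs G \<and> c w = i)))"

definition z_coloring :: "'a pair_pre_digraph \<Rightarrow> nat \<Rightarrow> ('a \<Rightarrow> nat) \<Rightarrow> bool" where
  "z_coloring G k c \<longleftrightarrow>
     grundy_coloring G k c \<and> (\<exists>u. nice_vertex G k c u \<and> c u = k)"

definition z_number :: "'a pair_pre_digraph \<Rightarrow> nat" where
  "z_number G = Max {k. \<exists>c. z_coloring G k c}"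

definition m_star :: "'a pair_pre_digraph \<Rightarrow> nat" where
  "m_star G = Max {k. \<exists>v \<in> pverts G. k \<le> degree G v \<and>
                        k \<le> card {w. (v, w) \<in> parcs G \<and> k \<le> degree G w}}"

text \<open>
  The tree \<open>R\<^sub>k\<close>. Since siblings have distinct colors in the canonical \<open>z\<close>-coloring, a vertex
  is identified with the list of the colors of the vertices on the path leading to it from the
  root, the root itself being omitted; thus the root is \<open>[]\<close>, and the color of any other
  vertex \<open>xs\<close> is \<open>last xs\<close>. The set \<open>child_colors k xs\<close> consists of the colors of the children
  of \<open>xs\<close>.
\<close>

fun child_colors :: "nat \<Rightarrow> nat list \<Rightarrow> nat set" where
  "child_colors k [] = {1..<k}"
| "child_colors k [i] = {1..<k} - {i}"
| "child_colors k [i, j] = {1..<j} - {i}"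
| "child_colors k (i # j # l # xs) = {1..<last (l # xs)}"

inductive_set R_verts :: "nat \<Rightarrow> nat list set" for k :: nat where
  root: "[] \<in> R_verts k"
| child: "xs \<in> R_verts k \<Longrightarrow> j \<in> child_colors k xs \<Longrightarrow> xs @ [j] \<in> R_verts k"

definition R_tree :: "nat \<Rightarrow> nat list pair_pre_digraph" where
  "R_tree k =
     \<lparr> pverts = R_verts k,
       parcs = {(xs, ys). xs \<in> R_verts k \<and> ys \<in> R_verts k \<and>
                          ((\<exists>j. ys = xs @ [j]) \<or> (\<exists>j. xs = ys @ [j]))} \<rparr>"

definition contains_copy :: "'a pair_pre_digraph \<Rightarrow> 'b pair_pre_digraph \<Rightarrow> bool" where
  "contains_copy G T \<longleftrightarrow> (\<exists>H. subgraph H (with_proj G) \<and> digraph_iso (with_proj T) H)"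

end

theory Submission
  imports Defs "HOL-Library.Sublist"
begin

text \<open>
  A nice vertex of color \<open>n\<close> has degree at least \<open>n - 1\<close> and \<open>n - 1\<close> neighbors that are b-vertices,
  hence of degree at least \<open>n - 1\<close>; so \<open>n \<le> m\<^sup>* + 1\<close>. For the lower bound, the girth makes a copy
  \<open>T\<close> of the tree induced, and a vertex off \<open>T\<close> sees at most one color on \<open>T\<close>, so that the canonical
  coloring of \<open>T\<close> can be extended greedily. Let \<open>H\<close> be the set of the vertices of degree at least
  \<open>k\<close>; each of them has at most \<open>k - 1\<close> neighbors in \<open>H\<close>. Greedy coloring with \<open>k\<close> colors could
  only fail at a bad vertex of \<open>H - T\<close>, one with a neighbor on \<open>T\<close> and \<open>k - 1\<close> neighbors in
  \<open>H - T\<close>. But a bad vertex has a neighbor in \<open>H - T\<close> that is not bad, so coloring first the bad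
  vertices, then the rest of \<open>H\<close>, then the vertices of degree less than \<open>k\<close> succeeds.
  If the minimum degree is \<open>k - 1\<close>, the tree can be mapped to the graph locally injectively, level
  by level, and such a map is injective because non-backtracking walks shorter than the girth are
  paths.
\<close>

subsection \<open>Closed walks and girth\<close>

abbreviation walk :: "'a pair_pre_digraph \<Rightarrow> 'a list \<Rightarrow> bool" where
  "walk G \<equiv> successively (\<lambda>x y. (x, y) \<in> parcs G)"

text \<open>Links the vertex lists used here to the arc lists of the library: zipping a walk with
  its tail gives its arcs.\<close>

lemma walk_arcs:
  assumes "walk G (x # xs)"
  shows "pcas x (zip (x # xs) xs) (last (x # xs))"
    and "set (zip (x # xs) xs) \<subseteq> parcs G"
    and "pawalk_verts x (zip (x # xs) xs) = x # xs"
  using assms by (induction xs arbitrary: x) auto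

lemma (in pair_graph) girth_le_length:
  assumes "walk G vs" "(last vs, hd vs) \<in> parcs G" "distinct vs" "3 \<le> length vs"
  shows "girth G \<le> enat (length vs)"
proof -
  obtain x ys where vs: "vs = x # ys" using assms(4) by (cases vs) auto
  \<comment> \<open>The library's closed walks return to their start; with \<open>x\<close> repeated
    at the end there are as many arcs as entries of \<open>vs\<close>.\<close>
  define xs where "xs = ys @ [x]"
  have w: "walk G (x # xs)"
    using assms(1,2) unfolding vs xs_def
    by (auto simp: successively_append_iff successively_Cons simp del: append_Cons)
       (auto simp: successively_append_iff successively_Cons split: if_splits)
  define p where "p = zip (x # xs) xs"
  have len: "length p = length vs" by (simp add: p_def xs_def vs)
  have "x \<in> pverts G"
    using assms(2) vs in_arcsD2 by auto
  then have "awalk x p x"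
    using walk_arcs[OF w] by (simp add: awalk_def p_def xs_def)
  moreover have "distinct (tl (pawalk_verts x p))"
    using walk_arcs(3)[OF w] assms(3) by (simp add: p_def xs_def vs)
  moreover have "p \<noteq> []" using len assms(4) by auto
  ultimately have "cycle p" unfolding cycle_def by auto
  then show ?thesis
    unfolding girth_def using len assms(4) by (metis (mono_tags, lifting) INF_lower mem_Collect_eq)
qed

text \<open>By induction the walk becomes a path when either end vertex is dropped, so only the two
  ends could agree. Then it closes up to a cycle with one vertex fewer than \<open>vs\<close>,
  shorter than the girth.\<close>

lemma (in pair_graph) walk_distinctI:
  assumes "walk G vs" and "enat (length vs) \<le> girth G"
    and nonbacktracking: "\<And>i. i + 2 < length vs \<Longrightarrow> vs ! i \<noteq> vs ! (i + 2)"
  shows "distinct vs"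
  using assms
proof (induction "length vs" arbitrary: vs rule: less_induct)
  case less
  show ?case
  proof (rule ccontr)
    assume nd: "\<not> distinct vs"
    then have ne: "vs \<noteq> []" by auto
    have d1: "distinct (butlast vs)"
    proof (rule less.hyps)
      show "length (butlast vs) < length vs" using ne by simp
      show "walk G (butlast vs)" using less.prems(1) ne
        by (metis append_butlast_last_id successively_append_iff)
      show "enat (length (butlast vs)) \<le> girth G"
        using less.prems(2) by (metis diff_le_self dual_order.trans enat_ord_simps(1) length_butlast)
      show "butlast vs ! i \<noteq> butlast vs ! (i + 2)" if "i + 2 < length (butlast vs)" for i
        using less.prems(3)[of i] that by (simp add: nth_butlast)
    qed
    have d2: "distinct (tl vs)"
    proof (rule less.hyps)
      show "length (tl vs) < length vs" using ne by simp
      show "walk G (tl vs)" using less.prems(1) ne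
        by (metis list.exhaust_sel successively_Cons successively.simps(1))
      show "enat (length (tl vs)) \<le> girth G"
        using less.prems(2) by (metis diff_le_self dual_order.trans enat_ord_simps(1) length_tl)
      show "tl vs ! i \<noteq> tl vs ! (i + 2)" if "i + 2 < length (tl vs)" for i
        using less.prems(3)[of "Suc i"] that by (simp add: nth_tl)
    qed
    obtain x ws where vs: "vs = x # ws" using ne by (cases vs) auto
    have ws: "ws \<noteq> []" using nd vs by auto
    then obtain us y where us: "ws = us @ [y]" by (metis rev_exhaust)
    have xy: "y = x" using nd d1 d2 by (auto simp: vs us)
    have adj: "(last (x # us), x) \<in> parcs G"
      using less.prems(1) unfolding vs us xy
      by (simp only: append_Cons[symmetric] successively_append_iff) auto
    \<comment> \<open>With \<open>us\<close> empty the closed walk is a loop, with one entry it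
      steps back and forth; both are excluded.\<close>
    then have "us \<noteq> []" using pair_no_loops by fastforce
    moreover have "length us \<noteq> 1"
      using less.prems(3)[of 0] by (auto simp: vs us xy length_Suc_conv)
    ultimately have "3 \<le> length (x # us)" by (cases us) (auto simp: Suc_le_eq)
    moreover have "walk G (x # us)"
      using less.prems(1) unfolding vs us xy
      by (simp only: append_Cons[symmetric] successively_append_iff)
    moreover have "distinct (x # us)" using d1 vs us by simp
    ultimately have "girth G \<le> enat (length (x # us))"
      using girth_le_length[of "x # us"] adj by simp
    then have "enat (length vs) \<le> enat (length (x # us))" using less.prems(2) by (rule order_trans[rotated])
    then show False by (simp add: vs us)
  qed
qed

subsection \<open>The tree \<open>R_verts\<close>\<close>

lemma child_colors_subset: "set xs \<subseteq> {1..<k} \<Longrightarrow> child_colors k xs \<subseteq> {1..<k}"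
proof (induction k xs rule: child_colors.induct)
  case (4 k i j l xs)
  then have "last (l # xs) < k" using last_in_set[of "l # xs"] by fastforce
  then show ?case by auto
qed auto

lemma R_verts_set: "xs \<in> R_verts k \<Longrightarrow> set xs \<subseteq> {1..<k}"
proof (induction rule: R_verts.induct)
  case (child xs j)
  then show ?case using child_colors_subset[of xs k] by auto
qed simp

lemma R_verts_snocD: "xs @ [j] \<in> R_verts k \<Longrightarrow> xs \<in> R_verts k \<and> j \<in> child_colors k xs"
  by (erule R_verts.cases) auto

lemma R_verts_take: "xs \<in> R_verts k \<Longrightarrow> take i xs \<in> R_verts k"
  by (induction rule: R_verts.induct) (auto simp: take_Cons' R_verts.intros)

lemma child_colors_Cons_Cons:
  "child_colors k (i # j # xs) = {1..<last (j # xs)} - (if xs = [] then {i} else {})"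
  by (cases xs) auto

text \<open>From depth two on the colors strictly decrease, so each further level costs at least one
  color.\<close>

lemma R_verts_last_bound:
  assumes "xs \<in> R_verts k" "2 \<le> length xs"
  shows "last xs + length xs \<le> xs ! 1 + 2"
  using assms
proof (induction rule: R_verts.induct)
  case (child xs j)
  consider "xs = []" | i where "xs = [i]" | i l ys where "xs = i # l # ys"
    by (metis list.exhaust)
  then show ?case
  proof cases
    case 3
    with child have "last xs + length xs \<le> xs ! 1 + 2" "j < last xs"
      by (auto simp: child_colors_Cons_Cons)
    then show ?thesis using 3 by (auto simp: nth_append)
  qed (use child in auto)
qed simp

lemma R_verts_nth_bounds: "xs \<in> R_verts k \<Longrightarrow> i < length xs \<Longrightarrow> 1 \<le> xs ! i \<and> xs ! i < k"
  using R_verts_set nth_mem by fastforce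

text \<open>The colors fall from at most \<open>k - 1\<close> at depth two to at least 1 at the end,
  which bounds the depth; at depth \<open>k\<close> both bounds are attained. These equality cases
  settle the situations in which the girth bound is just met.\<close>

lemma R_verts_length_le:
  assumes "xs \<in> R_verts k" "3 \<le> k"
  shows "length xs \<le> k"
    and "length xs = k \<Longrightarrow> last xs = 1"
    and "length xs = k \<Longrightarrow> xs ! 1 = k - 1"
proof -
  have *: "length xs \<le> k \<and> (length xs = k \<longrightarrow> last xs = 1 \<and> xs ! 1 = k - 1)"
  proof (cases "2 \<le> length xs")
    case True
    have "last xs = xs ! (length xs - 1)" using True by (intro last_conv_nth) auto
    then have "1 \<le> last xs" using R_verts_nth_bounds[OF assms(1), of "length xs - 1"] True by simp
    then show ?thesis
      using R_verts_last_bound[OF assms(1) True] R_verts_nth_bounds[OF assms(1), of 1] True by auto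
  qed (use assms in auto)
  show "length xs \<le> k" "length xs = k \<Longrightarrow> last xs = 1" "length xs = k \<Longrightarrow> xs ! 1 = k - 1"
    using * by auto
qed

text \<open>With the parent this makes at most \<open>k - 1\<close> tree neighbors, for which degree
  \<open>k - 1\<close> leaves room.\<close>

lemma card_child_colors:
  assumes "xs \<in> R_verts k" "xs \<noteq> []" "3 \<le> k"
  shows "card (child_colors k xs) \<le> k - 2"
proof -
  consider i where "xs = [i]" | i l ys where "xs = i # l # ys"
    using assms(2) by (metis list.exhaust)
  then show ?thesis
  proof cases
    case 1
    then have "i \<in> {1..<k}" using R_verts_set[OF assms(1)] by simp
    then show ?thesis by (simp add: 1)
  next
    case 2
    have "last xs \<in> {1..<k}" using R_verts_set[OF assms(1)] last_in_set[OF assms(2)] by blast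
    moreover have "card (child_colors k xs) \<le> card {1..<last xs}"
      by (intro card_mono) (auto simp: 2 child_colors_Cons_Cons)
    ultimately show ?thesis by auto
  qed
qed

section \<open>Adjacency and paths in the tree\<close>

definition R_adj :: "nat list \<Rightarrow> nat list \<Rightarrow> bool" where
  "R_adj xs ys \<longleftrightarrow> (\<exists>j. ys = xs @ [j]) \<or> (\<exists>j. xs = ys @ [j])"

lemma R_adj_sym: "R_adj xs ys \<Longrightarrow> R_adj ys xs"
  by (auto simp: R_adj_def)

lemma R_adj_take_Suc: "i < length xs \<Longrightarrow> R_adj (take i xs) (take (Suc i) xs)"
  by (auto simp: R_adj_def take_Suc_conv_app_nth)

lemma successively_map_upt:
  "(\<And>i. m \<le> i \<Longrightarrow> Suc i < n \<Longrightarrow> P (f i) (f (Suc i))) \<Longrightarrow> successively P (map f [m..<n])"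
  by (simp add: successively_conv_nth)

text \<open>The path climbs from \<open>xs\<close> to the longest common prefix and descends to \<open>ys\<close>.\<close>

lemma R_path_exists:
  assumes "xs \<in> R_verts k" "ys \<in> R_verts k"
    and "take m xs = take m ys" "m \<le> length xs" "m \<le> length ys"
  obtains P where "P \<noteq> []" "hd P = xs" "last P = ys" "distinct P" "set P \<subseteq> R_verts k"
    "successively R_adj P" "length P + 2 * m \<le> length xs + length ys + 1"
proof -
  obtain ps as bs where ps: "xs = ps @ as" "ys = ps @ bs" "as = [] \<or> bs = [] \<or> hd as \<noteq> hd bs"
    using longest_common_prefix by blast
  define l where "l = length ps"
  \<comment> \<open>The path turns at depth \<open>l\<close>, so each of the \<open>m\<close> common
    levels saves two vertices.\<close>
  have "m \<le> l"
  proof (rule ccontr)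
    assume "\<not> m \<le> l"
    then obtain a as' b bs' where *: "as = a # as'" "bs = b # bs'" and "l < m"
      using assms(4,5) ps by (cases as; cases bs) (auto simp: l_def)
    have "xs ! l = take m xs ! l" using \<open>l < m\<close> by simp
    also have "\<dots> = ys ! l" using \<open>l < m\<close> by (simp add: assms(3))
    finally show False using ps * by (simp add: l_def)
  qed
  \<comment> \<open>\<open>A\<close> starts at the turning point and \<open>B\<close> just below it,
    so that the turning point is listed once.\<close>
  define A where "A = map (\<lambda>i. take i xs) [l..<Suc (length xs)]"
  define B where "B = map (\<lambda>i. take i ys) [Suc l..<Suc (length ys)]"
  let ?P = "rev A @ B"
  have lx: "l \<le> length xs" "l \<le> length ys" by (auto simp: l_def ps)
  have A: "A \<noteq> []" "hd A = take l xs" "last A = xs" using lx by (auto simp: A_def hd_map last_map simp del: upt_Suc)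
  have B: "B \<noteq> [] \<Longrightarrow> hd B = take (Suc l) ys \<and> last B = ys \<and> l < length ys"
    using lx by (auto simp: B_def hd_map last_map simp del: upt_Suc)
  have eq: "take l xs = take l ys" by (simp add: l_def ps)
  have "hd ?P = xs" using A by (simp add: hd_rev)
  moreover have "last ?P = ys"
  proof (cases "B = []")
    case True
    then have "length ys = l" using lx by (auto simp: B_def simp del: upt_Suc)
    then have "take l ys = ys" by simp
    then show ?thesis using True A eq by (simp add: last_rev)
  qed (use B in simp)
  moreover have "distinct ?P"
  proof -
    have inj: "inj_on (\<lambda>i. take i zs) {..length zs}" for zs :: "nat list"
      by (rule inj_onI) (metis atMost_iff length_take min.absorb2)
    then have "distinct A" "distinct B"
      by (auto simp: A_def B_def distinct_map simp del: upt_Suc intro!: inj_on_subset[OF inj])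
    moreover have "set A \<inter> set B = {}"
    proof (rule ccontr)
      assume "set A \<inter> set B \<noteq> {}"
      then obtain i j where ij: "i \<le> length xs" "l < j" "j \<le> length ys" "take i xs = take j ys"
        by (auto simp: A_def B_def Suc_le_eq less_Suc_eq_le simp del: upt_Suc)
      then have "i = j" by (metis length_take min.absorb2)
      then have "take i xs ! l = take j ys ! l" "l < i" using ij by auto
      then have "xs ! l = ys ! l" "l < length xs" "l < length ys" using ij \<open>i = j\<close> by auto
      then show False using ps by (cases as; cases bs) (auto simp: l_def)
    qed
    ultimately show ?thesis by auto
  qed
  moreover have "set ?P \<subseteq> R_verts k"
    using assms(1,2) R_verts_take by (auto simp: A_def B_def simp del: upt_Suc)
  moreover have "successively R_adj ?P"
  proof -
    have "successively R_adj A" unfolding A_def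
      by (rule successively_map_upt) (auto intro: R_adj_take_Suc)
    then have "successively R_adj (rev A)"
      by (simp add: successively_rev) (metis (mono_tags, lifting) R_adj_sym successively_mono)
    moreover have "successively R_adj B" unfolding B_def
      by (rule successively_map_upt) (auto intro: R_adj_take_Suc)
    moreover have "R_adj (last (rev A)) (hd B)" if "B \<noteq> []"
      using A B[OF that] eq by (simp add: last_rev R_adj_take_Suc)
    ultimately show ?thesis using A by (auto simp: successively_append_iff)
  qed
  moreover have "length ?P + 2 * m \<le> length xs + length ys + 1"
  proof -
    have "length A = Suc (length xs) - l" "length B = length ys - l"
      by (simp_all add: A_def B_def del: upt_Suc)
    then show ?thesis using lx \<open>m \<le> l\<close> by simp
  qed
  moreover have "?P \<noteq> []" using A by simp
  ultimately show thesis using that by blast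
qed

subsection \<open>Greedy extension of Grundy colorings\<close>

text \<open>Smaller colors are demanded inside \<open>S\<close>, so this property of a partial
  coloring survives on \<open>S\<close> under every extension. The colors may be fewer than
  \<open>k\<close>.\<close>

definition grundy_on :: "'a pair_pre_digraph \<Rightarrow> nat \<Rightarrow> 'a set \<Rightarrow> ('a \<Rightarrow> nat) \<Rightarrow> bool" where
  "grundy_on G k S c \<longleftrightarrow>
     c ` S \<subseteq> {1..k} \<and>
     (\<forall>v \<in> S. \<forall>w \<in> S. (v, w) \<in> parcs G \<longrightarrow> c v \<noteq> c w) \<and>
     (\<forall>v \<in> S. \<forall>i \<in> {1..<c v}. \<exists>w \<in> S. (v, w) \<in> parcs G \<and> c w = i)"

abbreviation nbrs :: "'a pair_pre_digraph \<Rightarrow> 'a \<Rightarrow> 'a set" where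
  "nbrs G v \<equiv> parcs G `` {v}"

context pair_graph
begin

lemma finite_nbrs [simp]: "finite (nbrs G v)"
  by (simp add: finite_Image pair_finite_arcs)

lemma degree_eq_card_nbrs: "degree G v = card (nbrs G v)"
proof -
  have "out_arcs G v = Pair v ` nbrs G v" by (auto simp: out_arcs_def)
  then show ?thesis by (simp add: out_degree_def card_image inj_on_def)
qed

lemma arc_sym: "(x, y) \<in> parcs G \<Longrightarrow> (y, x) \<in> parcs G"
  using pair_sym_arcs by (auto simp: symmetric_def dest: symD)

text \<open>The vertices of \<open>A\<close> are colored one at a time, in any order, with the least
  color free at their colored neighbors. On \<open>S\<close> colors are counted rather than
  neighbors, because a vertex off the tree may have many tree neighbors of one color.\<close>

lemma greedy_extend:
  assumes "finite A" "A \<inter> S = {}" "grundy_on G k S c"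
    and "\<And>v. v \<in> A \<Longrightarrow> card (c ` (nbrs G v \<inter> S)) + card (nbrs G v \<inter> A) < k"
  shows "\<exists>c'. grundy_on G k (S \<union> A) c' \<and> (\<forall>v \<in> S. c' v = c v)"
  using assms
proof (induction A rule: finite_induct)
  case (insert a A)
  have "card (c ` (nbrs G v \<inter> S)) + card (nbrs G v \<inter> A) < k" if "v \<in> A" for v
  proof -
    have "card (nbrs G v \<inter> A) \<le> card (nbrs G v \<inter> insert a A)"
      by (rule card_mono) auto
    then show ?thesis using insert.prems(3)[of v] that by simp
  qed
  then obtain c' where c': "grundy_on G k (S \<union> A) c'" "\<forall>v \<in> S. c' v = c v"
    using insert.IH insert.prems(1,2) by auto
  define F where "F = c' ` (nbrs G a \<inter> (S \<union> A))"
  have "c' ` (nbrs G a \<inter> S) = c ` (nbrs G a \<inter> S)"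
    using c'(2) by (intro image_cong) auto
  then have "F = c ` (nbrs G a \<inter> S) \<union> c' ` (nbrs G a \<inter> A)"
    by (simp add: F_def Int_Un_distrib image_Un)
  then have "card F \<le> card (c ` (nbrs G a \<inter> S)) + card (c' ` (nbrs G a \<inter> A))"
    by (simp add: card_Un_le)
  also have "\<dots> \<le> card (c ` (nbrs G a \<inter> S)) + card (nbrs G a \<inter> insert a A)"
    by (intro add_mono order_trans[OF card_image_le] card_mono) auto
  also have "\<dots> < k" using insert.prems(3) by blast
  finally have "card F < card {1..k}" by simp
  then have "\<not> {1..k} \<subseteq> F" by (metis F_def card_mono finite_Int finite_imageI finite_nbrs leD)
  then obtain m0 where m0: "1 \<le> m0 \<and> m0 \<notin> F" "m0 \<le> k"
    by (meson atLeastAtMost_iff subsetI)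
  \<comment> \<open>Leastness puts every smaller color next to \<open>a\<close>; \<open>m0\<close>
    ensures that \<open>m\<close> is at most \<open>k\<close>.\<close>
  define m where "m = (LEAST m. 1 \<le> m \<and> m \<notin> F)"
  have m: "1 \<le> m" "m \<notin> F" "m \<le> k"
    using LeastI[of "\<lambda>m. 1 \<le> m \<and> m \<notin> F", OF m0(1)]
      Least_le[of "\<lambda>m. 1 \<le> m \<and> m \<notin> F", OF m0(1)] m0(2) by (auto simp: m_def)
  have less: "i \<in> F" if "1 \<le> i" "i < m" for i
    using not_less_Least[of i "\<lambda>m. 1 \<le> m \<and> m \<notin> F"] that by (auto simp: m_def)
  have a: "a \<notin> S \<union> A" using insert by auto
  have irr: "(a, a) \<notin> parcs G" using pair_no_loops by fastforce
  have "grundy_on G k (S \<union> insert a A) (c'(a := m))"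
    unfolding grundy_on_def
  proof (intro conjI ballI impI)
    show "(c'(a := m)) ` (S \<union> insert a A) \<subseteq> {1..k}"
      using c'(1) m by (auto simp: grundy_on_def)
  next
    fix v w assume vw: "v \<in> S \<union> insert a A" "w \<in> S \<union> insert a A" "(v, w) \<in> parcs G"
    consider "v = a" "w = a" | "v = a" "w \<in> S \<union> A" | "w = a" "v \<in> S \<union> A"
      | "v \<in> S \<union> A" "w \<in> S \<union> A" using vw by auto
    then show "(c'(a := m)) v \<noteq> (c'(a := m)) w"
    proof cases
      case 1 then show ?thesis using irr vw by simp
    next
      case 2
      then have "c' w \<in> F" using vw by (auto simp: F_def)
      then show ?thesis using 2 a m by auto
    next
      case 3
      then have "c' v \<in> F" using arc_sym[OF vw(3)] by (auto simp: F_def)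
      then show ?thesis using 3 a m by auto
    next
      case 4
      then show ?thesis using c'(1) vw(3) a by (auto simp: grundy_on_def)
    qed
  next
    fix v i assume v: "v \<in> S \<union> insert a A" and i: "i \<in> {1..<(c'(a := m)) v}"
    have "\<exists>w \<in> S \<union> A. (v, w) \<in> parcs G \<and> c' w = i"
    proof (cases "v = a")
      case True
      then have "i \<in> F" using i less by auto
      then show ?thesis using True by (auto simp: F_def)
    next
      case False
      then show ?thesis using c'(1) v i by (auto simp: grundy_on_def)
    qed
    then show "\<exists>w \<in> S \<union> insert a A. (v, w) \<in> parcs G \<and> (c'(a := m)) w = i"
      using a by (metis UnCI UnE fun_upd_apply insertCI)
  qed
  moreover have "\<forall>v \<in> S. (c'(a := m)) v = c v" using c'(2) a by auto
  ultimately show ?case by blast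
qed auto

end

subsection \<open>Upper bound\<close>

context pair_graph
begin

abbreviation "m_star_set \<equiv>
  {k. \<exists>v \<in> pverts G. k \<le> degree G v \<and> k \<le> card {w. (v, w) \<in> parcs G \<and> k \<le> degree G w}}"

lemma le_m_star:
  assumes "n \<in> m_star_set"
  shows "n \<le> m_star G"
proof -
  have "m_star_set \<subseteq> {..Max (degree G ` pverts G)}"
    using pair_finite_verts by (auto intro: order_trans Max_ge)
  then have "finite m_star_set" using finite_subset by blast
  then show ?thesis using assms unfolding m_star_def by (rule Max_ge)
qed

lemma b_vertex_degree:
  assumes "b_vertex G n c w" "c w \<in> {1..n}"
  shows "n - 1 \<le> degree G w"
proof -
  have "{1..n} - {c w} \<subseteq> c ` nbrs G w"
    using assms by (force simp: b_vertex_def)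
  then have "card ({1..n} - {c w}) \<le> card (nbrs G w)"
    by (meson card_image_le card_mono finite_imageI finite_nbrs order_trans)
  then show ?thesis using assms(2) by (simp add: degree_eq_card_nbrs)
qed

lemma z_coloring_le:
  assumes "z_coloring G n c"
  shows "n \<le> m_star G + 1"
proof -
  obtain u where u: "nice_vertex G n c u" "c u = n"
    using assms by (auto simp: z_coloring_def)
  define W where "W = {w. (u, w) \<in> parcs G \<and> n - 1 \<le> degree G w}"
  have sub: "{1..n} - {n} \<subseteq> c ` W"
  proof
    fix j assume j: "j \<in> {1..n} - {n}"
    then obtain w where "(u, w) \<in> parcs G" "c w = j" "b_vertex G n c w"
      using u by (force simp: nice_vertex_def)
    then show "j \<in> c ` W" using b_vertex_degree[of n c w] j by (auto simp: W_def)
  qed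
  have "W \<subseteq> nbrs G u" by (auto simp: W_def)
  then have fin: "finite W" using finite_nbrs finite_subset by blast
  have "card ({1..n} - {n}) \<le> card (c ` W)" using sub fin by (simp add: card_mono)
  also have "\<dots> \<le> card W" using fin by (rule card_image_le)
  finally have W: "n - 1 \<le> card W" by (cases n) auto
  moreover have "card W \<le> degree G u"
    unfolding degree_eq_card_nbrs using \<open>W \<subseteq> nbrs G u\<close> by (simp add: card_mono)
  ultimately have "n - 1 \<in> m_star_set"
    using u(1) by (intro CollectI bexI[of _ u]) (simp_all add: W_def nice_vertex_def)
  then show ?thesis using le_m_star by fastforce
qed

lemma z_number_eqI:
  assumes "z_coloring G k c" "m_star G = k - 1" "0 < k"
  shows "z_number G = k"
proof -
  have le: "n \<le> k" if "z_coloring G n c" for n c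
    using z_coloring_le[OF that] assms(2,3) by simp
  then have "finite {n. \<exists>c. z_coloring G n c}"
    by (auto intro: finite_subset[of _ "{..k}"])
  then show ?thesis
    unfolding z_number_def using assms(1) le by (intro Max_eqI) auto
qed

end

subsection \<open>Coloring a graph that contains \<open>R_tree\<close>\<close>

definition R_color :: "nat \<Rightarrow> nat list \<Rightarrow> nat" where
  "R_color k xs = (if xs = [] then k else last xs)"

lemma R_color_neq:
  assumes "xs @ [j] \<in> R_verts k"
  shows "R_color k xs \<noteq> j"
proof -
  have j: "j \<in> child_colors k xs" using assms R_verts_snocD by blast
  consider "xs = []" | i where "xs = [i]" | i l ys where "xs = i # l # ys"
    by (metis list.exhaust)
  then show ?thesis
    using j by cases (auto simp: R_color_def child_colors_Cons_Cons split: if_splits)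
qed

lemma R_color_range:
  assumes "xs \<in> R_verts k" "3 \<le> k"
  shows "R_color k xs \<in> {1..k}"
proof (cases "xs = []")
  case False
  then have "last xs \<in> {1..<k}" using R_verts_set[OF assms(1)] last_in_set by blast
  then show ?thesis using False by (simp add: R_color_def)
qed (use assms in \<open>simp add: R_color_def\<close>)

lemma R_color_grundy:
  assumes "xs \<in> R_verts k" "1 \<le> i" "i < R_color k xs"
  shows "\<exists>ys \<in> R_verts k. R_adj xs ys \<and> R_color k ys = i"
proof -
  have child: ?thesis if "i \<in> child_colors k xs"
    using R_verts.child[OF assms(1) that]
    by (intro bexI[of _ "xs @ [i]"]) (auto simp: R_adj_def R_color_def)
  consider "xs = []" | l where "xs = [l]" | l j ys where "xs = l # j # ys"
    by (metis list.exhaust)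
  then show ?thesis
  proof cases
    case 1
    then show ?thesis using assms child by (simp add: R_color_def)
  next
    case 2
    then have "l < k" using R_verts_set[OF assms(1)] by simp
    then show ?thesis using 2 assms child by (simp add: R_color_def)
  next
    case 3
    show ?thesis
    proof (cases "ys = [] \<and> i = l")
      \<comment> \<open>At depth two the children omit the color of the parent; the parent itself
        supplies it.\<close>
      case True
      have "[l] \<in> R_verts k" using R_verts_take[OF assms(1), of 1] 3 by simp
      then show ?thesis using 3 True
        by (intro bexI[of _ "[l]"]) (auto simp: R_adj_def R_color_def)
    next
      case False
      then show ?thesis using 3 assms child
        by (auto simp: R_color_def child_colors_Cons_Cons)
    qed
  qed
qed

text \<open>Makes the children of the root b-vertices: the root supplies color \<open>k\<close>,
  their own children the other colors.\<close>

lemma R_color_root_nbr: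
  assumes "j \<in> {1..<k}" "i \<in> {1..k} - {j}"
  shows "\<exists>ys \<in> R_verts k. R_adj [j] ys \<and> R_color k ys = i"
proof (cases "i = k")
  case True
  then show ?thesis
    by (intro bexI[of _ "[]"]) (auto simp: R_adj_def R_color_def R_verts.root)
next
  case False
  have "[j] \<in> R_verts k" using R_verts.child[OF R_verts.root, of j k] assms by simp
  then have "[j] @ [i] \<in> R_verts k" using assms False by (intro R_verts.child) auto
  then show ?thesis
    by (intro bexI[of _ "[j, i]"]) (auto simp: R_adj_def R_color_def)
qed

text \<open>Both claims reduce to this setting: the map comes from a given copy of the tree, or is
  built using the minimum degree.\<close>

locale R_embedding = pair_graph G for G :: "'a pair_pre_digraph" +
  fixes k :: nat and f :: "nat list \<Rightarrow> 'a"
  assumes k_ge_3: "3 \<le> k"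
    and arc_child: "xs @ [j] \<in> R_verts k \<Longrightarrow> (f xs, f (xs @ [j])) \<in> parcs G"
    and inj: "inj_on f (R_verts k)"
    and girth: "enat (2 * k + 2) \<le> girth G"
    and m_star: "m_star G = k - 1"
begin

abbreviation T where "T \<equiv> f ` R_verts k"

definition H where "H = {v \<in> pverts G. k \<le> degree G v}"

lemma arc_R_adj: "xs \<in> R_verts k \<Longrightarrow> ys \<in> R_verts k \<Longrightarrow> R_adj xs ys \<Longrightarrow> (f xs, f ys) \<in> parcs G"
  using arc_child arc_sym by (auto simp: R_adj_def)

lemma T_subset: "T \<subseteq> pverts G"
proof
  fix v assume "v \<in> T"
  then obtain xs where xs: "v = f xs" "xs \<in> R_verts k" by auto
  \<comment> \<open>Every tree vertex lies on a tree edge, and ends of arcs are vertices of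
    \<open>G\<close>.\<close>
  obtain ys where "ys \<in> R_verts k" "R_adj xs ys"
  proof (cases xs rule: rev_cases)
    case Nil
    have "[1] \<in> R_verts k" using R_verts.child[OF R_verts.root, of 1 k] k_ge_3 by simp
    then show ?thesis using that Nil by (auto simp: R_adj_def)
  next
    case (snoc zs z)
    then show ?thesis using that xs R_verts_snocD by (auto simp: R_adj_def)
  qed
  then show "v \<in> pverts G" using arc_R_adj xs in_arcsD1 by blast
qed

text \<open>Otherwise \<open>v\<close> would witness that \<open>m_star G\<close> is at least
  \<open>k\<close>.\<close>

lemma card_nbrs_H:
  assumes "v \<in> H" shows "card (nbrs G v \<inter> H) < k"
proof (rule ccontr)
  have "nbrs G v \<inter> H = {w. (v, w) \<in> parcs G \<and> k \<le> degree G w}"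
    using in_arcsD2 by (auto simp: H_def)
  moreover assume "\<not> card (nbrs G v \<inter> H) < k"
  ultimately have "k \<in> m_star_set" using assms by (auto simp: H_def)
  then show False using le_m_star m_star k_ge_3 by fastforce
qed

text \<open>A cycle composed of a tree path and a path \<open>q\<close> outside the tree; \<open>m\<close> bounds from below the
  length of the common prefix of the two ends of the tree path.\<close>

lemma cycle_length_bound:
  assumes R: "xs \<in> R_verts k" "ys \<in> R_verts k"
    and m: "take m xs = take m ys" "m \<le> length xs" "m \<le> length ys"
    and q: "distinct q" "walk G q" "set q \<inter> T = {}"
    and link: "if q = [] then (f ys, f xs) \<in> parcs G
               else (f ys, hd q) \<in> parcs G \<and> (last q, f xs) \<in> parcs G"
    and long: "length q = 0 \<Longrightarrow> xs \<noteq> ys \<and> \<not> R_adj xs ys" "length q = 1 \<Longrightarrow> xs \<noteq> ys"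
  shows "2 * k + 2 * m + 1 \<le> length xs + length ys + length q"
proof -
  obtain P where P: "P \<noteq> []" "hd P = xs" "last P = ys" "distinct P" "set P \<subseteq> R_verts k"
    "successively R_adj P" "length P + 2 * m \<le> length xs + length ys + 1"
    using R_path_exists[OF R m] by blast
  let ?C = "map f P @ q"
  have "walk G (map f P)" unfolding successively_map
    using P(6) by (rule successively_mono) (use arc_R_adj P(5) in auto)
  then have "walk G ?C"
    using q(2) link P(1-3) by (auto simp: successively_append_iff last_map split: if_splits)
  moreover have "(last ?C, hd ?C) \<in> parcs G"
    using link P by (auto simp: last_map hd_map split: if_splits)
  moreover have "distinct ?C"
    using P q inj by (auto simp: distinct_map intro: inj_on_subset)
  \<comment> \<open>Fewer than three vertices would mean a tree path of at most two vertices with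
    \<open>q\<close> empty, or of one vertex with a single vertex in \<open>q\<close>;
    \<open>long\<close> forbids both.\<close>
  moreover have "3 \<le> length ?C"
  proof (rule ccontr)
    assume "\<not> 3 \<le> length ?C"
    then have len: "length P + length q \<le> 2" by simp
    show False
    proof (cases P rule: remdups_adj.cases)
      case (3 a b as)
      then show False using len P long by auto
    qed (use len P long in \<open>auto simp: le_Suc_eq\<close>)
  qed
  ultimately have "girth G \<le> enat (length ?C)" by (rule girth_le_length)
  with girth have "enat (2 * k + 2) \<le> enat (length ?C)" by (rule order_trans)
  then have "2 * k + 2 \<le> length P + length q" by simp
  then show ?thesis using P(7) by simp
qed

text \<open>The copy is induced: a chord would close a tree path with at most
  \<open>2 * k + 1\<close> vertices to a cycle shorter than the girth. Hence the canonical coloring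
  is proper on \<open>T\<close>.\<close>

lemma arc_T_imp_R_adj:
  assumes "xs \<in> R_verts k" "ys \<in> R_verts k" "(f xs, f ys) \<in> parcs G"
  shows "R_adj xs ys"
proof (rule ccontr)
  assume "\<not> R_adj xs ys"
  moreover have "xs \<noteq> ys" using assms(3) pair_no_loops by fastforce
  ultimately have "2 * k + 2 * 0 + 1 \<le> length xs + length ys + length ([] :: 'a list)"
    using assms arc_sym by (intro cycle_length_bound) auto
  then show False using R_verts_length_le(1)[OF assms(1) k_ge_3] R_verts_length_le(1)[OF assms(2) k_ge_3]
    by simp
qed

section \<open>The canonical coloring carried over to the copy\<close>

definition T_color where "T_color v = R_color k (inv_into (R_verts k) f v)"

lemma T_color_f: "xs \<in> R_verts k \<Longrightarrow> T_color (f xs) = R_color k xs"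
  using inj by (simp add: T_color_def)

lemma grundy_on_T: "grundy_on G k T T_color"
  unfolding grundy_on_def
proof (intro conjI ballI impI)
  show "T_color ` T \<subseteq> {1..k}"
    using R_color_range[OF _ k_ge_3] by (auto simp: T_color_f)
next
  fix v w assume "v \<in> T" "w \<in> T" "(v, w) \<in> parcs G"
  then obtain xs ys where *: "xs \<in> R_verts k" "ys \<in> R_verts k" "v = f xs" "w = f ys" "R_adj xs ys"
    using arc_T_imp_R_adj by blast
  then show "T_color v \<noteq> T_color w"
    using R_color_neq by (force simp: T_color_f R_adj_def R_color_def)
next
  fix v i assume "v \<in> T" "i \<in> {1..<T_color v}"
  then obtain xs where xs: "xs \<in> R_verts k" "v = f xs" "1 \<le> i" "i < R_color k xs"
    by (auto simp: T_color_f)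
  then obtain ys where "ys \<in> R_verts k" "R_adj xs ys" "R_color k ys = i"
    using R_color_grundy by blast
  then show "\<exists>w \<in> T. (v, w) \<in> parcs G \<and> T_color w = i"
    using xs arc_R_adj by (auto simp: T_color_f)
qed

text \<open>By the girth, two neighbors on the tree are at distance \<open>2 * k\<close> from each other, hence
  both at depth \<open>k\<close>, where the only color is 1.\<close>

lemma card_colors_T_le_1:
  assumes "v \<notin> T"
  shows "card (T_color ` (nbrs G v \<inter> T)) \<le> 1"
proof -
  have "a = b" if a: "a \<in> T_color ` (nbrs G v \<inter> T)" and b: "b \<in> T_color ` (nbrs G v \<inter> T)" for a b
  proof -
    obtain xs ys where *: "xs \<in> R_verts k" "(v, f xs) \<in> parcs G" "a = R_color k xs"
      "ys \<in> R_verts k" "(v, f ys) \<in> parcs G" "b = R_color k ys"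
      using a b by (auto simp: T_color_f)
    show ?thesis
    proof (cases "xs = ys")
      case False
      have "2 * k + 2 * 0 + 1 \<le> length xs + length ys + length [v]"
        using False * assms arc_sym by (intro cycle_length_bound) auto
      then have "length xs = k" "length ys = k"
        using R_verts_length_le(1)[OF *(1) k_ge_3] R_verts_length_le(1)[OF *(4) k_ge_3] by auto
      then show ?thesis
        using * R_verts_length_le(2)[OF *(1) k_ge_3] R_verts_length_le(2)[OF *(4) k_ge_3] k_ge_3
        by (auto simp: R_color_def)
    qed (use * in simp)
  qed
  then have "\<forall>a \<in> T_color ` (nbrs G v \<inter> T). \<forall>b \<in> T_color ` (nbrs G v \<inter> T). a = b"
    by blast
  moreover have "finite (T_color ` (nbrs G v \<inter> T))" by simp
  ultimately show ?thesis unfolding One_nat_def by (rule iffD2[OF card_le_Suc0_iff_eq, rotated])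
qed

definition Bad where
  "Bad = {v \<in> H - T. nbrs G v \<inter> T \<noteq> {} \<and> k - 1 \<le> card (nbrs G v \<inter> (H - T))}"

text \<open>If \<open>y\<close> and all its neighbors outside the tree were bad, choosing for each of these at least
  \<open>k\<close> vertices a neighbor on the tree would, by the girth, hit a different one of the \<open>k - 1\<close>
  branches of the tree every time.\<close>

lemma Bad_has_good_nbr:
  assumes y: "y \<in> Bad"
  shows "\<exists>x \<in> nbrs G y \<inter> (H - T). x \<notin> Bad"
proof (rule ccontr)
  assume "\<not> ?thesis"
  then have allbad: "nbrs G y \<inter> (H - T) \<subseteq> Bad" by blast
  define Y where "Y = insert y (nbrs G y \<inter> (H - T))"
  have "y \<notin> nbrs G y" using pair_no_loops by fastforce
  then have "card Y = Suc (card (nbrs G y \<inter> (H - T)))" by (simp add: Y_def)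
  then have cardY: "k \<le> card Y" using y by (auto simp: Bad_def)
  have "Y \<subseteq> Bad" using y allbad by (simp add: Y_def)
  then have "\<forall>z \<in> Y. \<exists>xs \<in> R_verts k. (z, f xs) \<in> parcs G"
    by (auto simp: Bad_def)
  then obtain t where t: "\<And>z. z \<in> Y \<Longrightarrow> t z \<in> R_verts k" "\<And>z. z \<in> Y \<Longrightarrow> (z, f (t z)) \<in> parcs G"
    by metis
  have outside: "Y \<inter> T = {}" using y by (auto simp: Y_def Bad_def)
  \<comment> \<open>Two members of \<open>Y\<close> are adjacent or joined through \<open>y\<close>,
    so at most three vertices off the tree close the cycle.\<close>
  have bound: "2 * k + 2 * m \<le> length (t z) + length (t w) + 2"
    if zw: "z \<in> Y" "w \<in> Y" "z \<noteq> w" and m: "take m (t z) = take m (t w)" "m \<le> length (t z)" "m \<le> length (t w)"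
    for z w m
  proof -
    consider "(w, z) \<in> parcs G" | "(w, y) \<in> parcs G" "(y, z) \<in> parcs G" "y \<noteq> w" "y \<noteq> z"
      using zw arc_sym by (auto simp: Y_def)
    then show ?thesis
    proof cases
      case 1
      have "2 * k + 2 * m + 1 \<le> length (t z) + length (t w) + length [w, z]"
        using zw m 1 t outside arc_sym by (intro cycle_length_bound) auto
      then show ?thesis by simp
    next
      case 2
      have "y \<in> Y" by (simp add: Y_def)
      then have "2 * k + 2 * m + 1 \<le> length (t z) + length (t w) + length [w, y, z]"
        using zw m 2 t outside arc_sym by (intro cycle_length_bound) auto
      then show ?thesis by simp
    qed
  qed
  have len: "length (t z) \<le> k" if "z \<in> Y" for z
    using R_verts_length_le(1)[OF t(1)[OF that] k_ge_3] .
  \<comment> \<open>A tree neighbor at the root would give \<open>2 * k\<close> \<le>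
    \<open>k + 2\<close> by \<open>bound\<close> with \<open>m = 0\<close>.\<close>
  have ne: "t z \<noteq> []" if "z \<in> Y" for z
  proof
    assume "t z = []"
    obtain w where w: "w \<in> Y" "w \<noteq> z"
    proof -
      have "\<not> Y \<subseteq> {z}" using cardY k_ge_3 card_mono[of "{z}" Y] by fastforce
      then show ?thesis using that by blast
    qed
    then show False using bound[of z w 0] that len[of w] k_ge_3 \<open>t z = []\<close> by simp
  qed
  \<comment> \<open>In a common branch, \<open>bound\<close> with \<open>m = 1\<close> forces both
    tree neighbors to depth \<open>k\<close>. Then both second entries are \<open>k - 1\<close>, so
    the common prefix has length at least two, and \<open>bound\<close> with \<open>m = 2\<close>
    fails.\<close>
  have "inj_on (\<lambda>z. hd (t z)) Y"
  proof (rule inj_onI, rule ccontr)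
    fix z w assume zw: "z \<in> Y" "w \<in> Y" "hd (t z) = hd (t w)" "z \<noteq> w"
    obtain a as where za: "t z = a # as" using ne[OF zw(1)] by (cases "t z") auto
    obtain bs where wb: "t w = a # bs" using ne[OF zw(2)] zw(3) za by (cases "t w") auto
    have lk: "length (t z) = k" "length (t w) = k"
      using bound[of z w 1] zw za wb len[of z] len[of w] by auto
    have "t z ! 1 = k - 1" "t w ! 1 = k - 1"
      using R_verts_length_le(3)[OF t(1) k_ge_3] zw lk by auto
    then have "take 2 (t z) = take 2 (t w)"
      using za wb lk k_ge_3 by (cases as; cases bs) auto
    then show False using bound[of z w 2] zw lk k_ge_3 by simp
  qed
  moreover have "(\<lambda>z. hd (t z)) ` Y \<subseteq> {1..<k}"
    using R_verts_set[OF t(1)] hd_in_set[OF ne] by fast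
  ultimately have "card Y \<le> card {1..<k}" by (intro card_inj_on_le) auto
  then show False using cardY k_ge_3 by simp
qed

lemma grundy_on_pverts_exists:
  "\<exists>c. grundy_on G k (pverts G) c \<and> (\<forall>v \<in> T. c v = T_color v)"
proof -
  have fin: "finite (pverts G)" by (rule pair_finite_verts)
  have finH: "finite H" using fin by (simp add: H_def)
  have BadH: "Bad \<subseteq> H - T" by (auto simp: Bad_def)
  have "\<exists>c. grundy_on G k (T \<union> Bad) c \<and> (\<forall>v \<in> T. c v = T_color v)"
  proof (rule greedy_extend[OF _ _ grundy_on_T])
    show "finite Bad" using BadH finH finite_subset by blast
    show "Bad \<inter> T = {}" using BadH by blast
    fix v assume v: "v \<in> Bad"
    obtain x where x: "x \<in> nbrs G v \<inter> H" "x \<notin> Bad" using Bad_has_good_nbr[OF v] by blast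
    \<comment> \<open>The good neighbor leaves at most \<open>k - 2\<close> bad ones, and the tree
      adds at most one color.\<close>
    have "nbrs G v \<inter> Bad \<subset> nbrs G v \<inter> H" using x BadH by blast
    then have "card (nbrs G v \<inter> Bad) < card (nbrs G v \<inter> H)" by (intro psubset_card_mono) auto
    moreover have "card (nbrs G v \<inter> H) < k" using card_nbrs_H v BadH by blast
    moreover have "card (T_color ` (nbrs G v \<inter> T)) \<le> 1" using card_colors_T_le_1 v BadH by blast
    ultimately show "card (T_color ` (nbrs G v \<inter> T)) + card (nbrs G v \<inter> Bad) < k" by linarith
  qed
  then obtain c1 where c1: "grundy_on G k (T \<union> Bad) c1" "\<forall>v \<in> T. c1 v = T_color v" by blast
  have c2_exists: "\<exists>c. grundy_on G k (T \<union> Bad \<union> (H - T - Bad)) c \<and> (\<forall>v \<in> T \<union> Bad. c v = c1 v)"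
  proof (rule greedy_extend[OF _ _ c1(1)])
    fix v assume v: "v \<in> H - T - Bad"
    let ?N = "nbrs G v"
    have "c1 ` (?N \<inter> T) = T_color ` (?N \<inter> T)"
      using c1(2) by (intro image_cong) auto
    then have "c1 ` (?N \<inter> (T \<union> Bad)) = T_color ` (?N \<inter> T) \<union> c1 ` (?N \<inter> Bad)"
      by (simp add: Int_Un_distrib image_Un)
    then have "card (c1 ` (?N \<inter> (T \<union> Bad))) \<le> card (T_color ` (?N \<inter> T)) + card (c1 ` (?N \<inter> Bad))"
      by (simp add: card_Un_le)
    also have "\<dots> \<le> card (T_color ` (?N \<inter> T)) + card (?N \<inter> Bad)"
      by (simp add: card_image_le)
    finally have "card (c1 ` (?N \<inter> (T \<union> Bad))) + card (?N \<inter> (H - T - Bad))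
        \<le> card (T_color ` (?N \<inter> T)) + (card (?N \<inter> Bad) + card (?N \<inter> (H - T - Bad)))"
      by simp
    also have "card (?N \<inter> Bad) + card (?N \<inter> (H - T - Bad)) = card (?N \<inter> (H - T))"
      using BadH by (subst card_Un_disjoint[symmetric]) (auto intro: arg_cong[where f = card])
    finally have le: "card (c1 ` (?N \<inter> (T \<union> Bad))) + card (?N \<inter> (H - T - Bad))
        \<le> card (T_color ` (?N \<inter> T)) + card (?N \<inter> (H - T))" .
    show "card (c1 ` (?N \<inter> (T \<union> Bad))) + card (?N \<inter> (H - T - Bad)) < k"
    \<comment> \<open>Without tree neighbors the bound on neighbors in \<open>H\<close> suffices;
      otherwise, as \<open>v\<close> is not bad, at most \<open>k - 2\<close> neighbors in
      \<open>H - T\<close> join one tree color.\<close>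
    proof (cases "?N \<inter> T = {}")
      case True
      have "card (?N \<inter> (H - T)) \<le> card (?N \<inter> H)" by (intro card_mono) auto
      then show ?thesis using le True card_nbrs_H[of v] v by simp
    next
      case False
      then have "card (?N \<inter> (H - T)) < k - 1" using v by (auto simp: Bad_def)
      then show ?thesis using le card_colors_T_le_1[of v] v by simp
    qed
  qed (use finH in auto)
  then obtain c2 where c2: "grundy_on G k (T \<union> H) c2" "\<forall>v \<in> T. c2 v = T_color v"
  proof -
    have "T \<union> Bad \<union> (H - T - Bad) = T \<union> H" using BadH by blast
    then show ?thesis using that c1(2) c2_exists by auto
  qed
  have "\<exists>c. grundy_on G k (T \<union> H \<union> (pverts G - (T \<union> H))) c \<and> (\<forall>v \<in> T \<union> H. c v = c2 v)"
  proof (rule greedy_extend[OF _ _ c2(1)])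
    fix v assume v: "v \<in> pverts G - (T \<union> H)"
    let ?N = "nbrs G v"
    have "card (c2 ` (?N \<inter> (T \<union> H))) + card (?N \<inter> (pverts G - (T \<union> H)))
        \<le> card (?N \<inter> (T \<union> H)) + card (?N \<inter> (pverts G - (T \<union> H)))"
      by (simp add: card_image_le)
    also have "\<dots> = card (?N \<inter> (T \<union> H) \<union> ?N \<inter> (pverts G - (T \<union> H)))"
      by (subst card_Un_disjoint) auto
    also have "\<dots> \<le> card ?N" by (intro card_mono) auto
    also have "\<dots> < k" using v by (auto simp: H_def degree_eq_card_nbrs)
    finally show "card (c2 ` (?N \<inter> (T \<union> H))) + card (?N \<inter> (pverts G - (T \<union> H))) < k" .
  qed (use fin in auto)
  moreover have "T \<union> H \<union> (pverts G - (T \<union> H)) = pverts G" using T_subset by (auto simp: H_def)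
  ultimately show ?thesis using c2(2) by auto
qed

text \<open>The extension keeps the colors on \<open>T\<close>, where the root and its children
  already show all \<open>k\<close> colors and the neighbors that make the root nice.\<close>

lemma z_coloring_exists: "\<exists>c. z_coloring G k c"
proof -
  obtain c where c: "grundy_on G k (pverts G) c" "\<forall>v \<in> T. c v = T_color v"
    using grundy_on_pverts_exists by blast
  have cf: "c (f xs) = R_color k xs" if "xs \<in> R_verts k" for xs
    using c(2) that by (simp add: T_color_f)
  have single: "[j] \<in> R_verts k \<and> c (f [j]) = j" if "j \<in> {1..<k}" for j
    using R_verts.child[OF R_verts.root, of j k] that cf[of "[j]"] by (simp add: R_color_def)
  have root: "c (f []) = k" by (simp add: cf R_verts.root R_color_def)
  have rootV: "f [] \<in> pverts G" using T_subset R_verts.root by blast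
  have b: "b_vertex G k c (f [j])" if j: "j \<in> {1..<k}" for j
    unfolding b_vertex_def
  proof (intro conjI ballI)
    show "f [j] \<in> pverts G" using single[OF j] T_subset by blast
    fix i assume "i \<in> {1..k} - {c (f [j])}"
    then have i: "i \<in> {1..k} - {j}" using single[OF j] by simp
    obtain ys where "ys \<in> R_verts k" "R_adj [j] ys" "R_color k ys = i"
      using R_color_root_nbr[OF j i] by blast
    then show "\<exists>w. (f [j], w) \<in> parcs G \<and> c w = i"
      using arc_R_adj single[OF j] cf by blast
  qed
  have "nice_vertex G k c (f [])"
    unfolding nice_vertex_def
  proof (intro conjI ballI rootV)
    fix j assume "j \<in> {1..k} - {c (f [])}"
    then have j: "j \<in> {1..<k}" using root by auto
    then have "(f [], f [j]) \<in> parcs G" using arc_child[of "[]" j] single by simp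
    then show "\<exists>w. (f [], w) \<in> parcs G \<and> c w = j \<and> b_vertex G k c w"
      using single[OF j] b[OF j] by blast
  qed
  moreover have "c ` pverts G = {1..k}"
  proof
    show "c ` pverts G \<subseteq> {1..k}" using c(1) by (simp add: grundy_on_def)
    show "{1..k} \<subseteq> c ` pverts G"
    proof
      fix j assume "j \<in> {1..k}"
      then consider "j = k" | "j \<in> {1..<k}" by fastforce
      then show "j \<in> c ` pverts G"
      proof cases
        case 1 then show ?thesis using root rootV by (metis imageI)
      next
        case 2 then show ?thesis using single[OF 2] T_subset by (metis imageI subsetD)
      qed
    qed
  qed
  moreover have "\<forall>(v, w) \<in> parcs G. c v \<noteq> c w"
    using c(1) in_arcsD1 in_arcsD2 unfolding grundy_on_def by blast
  moreover have "\<exists>w. (v, w) \<in> parcs G \<and> c w = i"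
    if "v \<in> pverts G" "i \<in> {1..k}" "i < c v" for v i
  proof -
    have "i \<in> {1..<c v}" using that by simp
    then show ?thesis using c(1) that(1) unfolding grundy_on_def by blast
  qed
  ultimately have "z_coloring G k c"
    using root unfolding z_coloring_def grundy_coloring_def proper_coloring_def by blast
  then show ?thesis by blast
qed

lemma z_number_eq: "z_number G = k"
  using z_coloring_exists z_number_eqI m_star k_ge_3 by fastforce

end

subsection \<open>Finding \<open>R_tree\<close>\<close>

lemma contains_copy_R_treeD:
  assumes "contains_copy G (R_tree k)"
  obtains f where "\<And>xs j. xs @ [j] \<in> R_verts k \<Longrightarrow> (f xs, f (xs @ [j])) \<in> parcs G"
    and "inj_on f (R_verts k)"
proof -
  interpret R: pre_digraph "with_proj (R_tree k)" .
  obtain K h where K: "subgraph K (with_proj G)" "R.digraph_isomorphism h"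
    "K = app_iso h (with_proj (R_tree k))"
    using assms by (auto simp: contains_copy_def digraph_iso_def)
  \<comment> \<open>A subgraph inherits \<open>fst\<close> and \<open>snd\<close> as tail and head,
    so the image of a tree arc is the pair of the images of its ends.\<close>
  have KG: "arcs K \<subseteq> parcs G" "tail K = fst" "head K = snd"
    using K(1) by (auto simp: subgraph_def compatible_def)
  show thesis
  proof (rule that[of "iso_verts h"])
    show "inj_on (iso_verts h) (R_verts k)"
      using R.digraph_isomorphism_inj_on_verts[OF K(2)] by (simp add: R_tree_def)
    fix xs j assume "xs @ [j] \<in> R_verts k"
    then have e: "(xs, xs @ [j]) \<in> arcs (with_proj (R_tree k))"
      using R_verts_snocD by (auto simp: R_tree_def)
    let ?a = "iso_arcs h (xs, xs @ [j])"
    have "?a \<in> parcs G" using e KG(1) K(3) by auto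
    moreover have "fst ?a = iso_verts h xs" "snd ?a = iso_verts h (xs @ [j])"
      using R.iso_verts_tail[OF K(2) e] R.iso_verts_head[OF K(2) e] KG K(3) by auto
    ultimately show "(iso_verts h xs, iso_verts h (xs @ [j])) \<in> parcs G"
      by (metis prod.collapse)
  qed
qed

text \<open>Reversed lists turn the parent into the tail. The choice function \<open>h v A C\<close> is meant to map
  \<open>C\<close> injectively to neighbors of \<open>v\<close> outside \<open>A\<close>.\<close>

fun place :: "('a \<Rightarrow> 'a set \<Rightarrow> nat set \<Rightarrow> nat \<Rightarrow> 'a) \<Rightarrow> 'a \<Rightarrow> nat \<Rightarrow> nat list \<Rightarrow> 'a" where
  "place h u k [] = u"
| "place h u k [j] = h u {} (child_colors k []) j"
| "place h u k (j # i # r) = h (place h u k (i # r)) {place h u k r} (child_colors k (rev (i # r))) j"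

lemma (in pair_graph) R_embedding_exists:
  assumes "3 \<le> k" and u: "u \<in> pverts G"
    and deg: "\<And>v. v \<in> pverts G \<Longrightarrow> k - 1 \<le> degree G v"
    and girth: "enat (2 * k + 2) \<le> girth G"
  obtains f where "\<And>xs j. xs @ [j] \<in> R_verts k \<Longrightarrow> (f xs, f (xs @ [j])) \<in> parcs G"
    and "inj_on f (R_verts k)"
proof -
  define h where "h v A C = (SOME g. inj_on g C \<and> g ` C \<subseteq> nbrs G v - A)" for v A and C :: "nat set"
  have h: "inj_on (h v A C) C \<and> h v A C ` C \<subseteq> nbrs G v - A"
    if v: "v \<in> pverts G" and fin: "finite A" "finite C" and le: "card C + card A \<le> k - 1" for v A C
  proof -
    have "card C \<le> card (nbrs G v - A)"
      using deg[OF v] le diff_card_le_card_Diff[OF fin(1), of "nbrs G v"]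
      by (simp add: degree_eq_card_nbrs)
    then have "\<exists>g. inj_on g C \<and> g ` C \<subseteq> nbrs G v - A"
      using card_le_inj[OF fin(2), of "nbrs G v - A"] by auto
    then show ?thesis unfolding h_def by (rule someI_ex)
  qed
  define f where "f xs = place h u k (rev xs)" for xs
  define par where "par xs = (if xs = [] then {} else {f (butlast xs)})" for xs
  have f_snoc: "f (xs @ [j]) = h (f xs) (par xs) (child_colors k xs) j" for xs j
    by (cases xs rule: rev_cases) (auto simp: f_def par_def)
  have fin_child: "finite (child_colors k xs)" for xs
    by (induction k xs rule: child_colors.induct) auto
  have fin_par: "finite (par xs)" for xs by (simp add: par_def)
  \<comment> \<open>The root has \<open>k - 1\<close> children and no parent, any other vertex at
    most \<open>k - 2\<close> children and one parent; so the minimum degree suffices.\<close>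
  have card: "card (child_colors k xs) + card (par xs) \<le> k - 1" if "xs \<in> R_verts k" for xs
    using card_child_colors[OF that _ assms(1)] assms(1) by (cases "xs = []") (auto simp: par_def)
  have step: "inj_on (\<lambda>j. f (xs @ [j])) (child_colors k xs) \<and>
      (\<forall>j \<in> child_colors k xs. f (xs @ [j]) \<in> nbrs G (f xs) - par xs)"
    if "xs \<in> R_verts k" "f xs \<in> pverts G" for xs
    using h[OF that(2) fin_par fin_child card[OF that(1)]]
    by (simp add: f_snoc image_subset_iff del: Image_singleton_iff)
  have fV: "f xs \<in> pverts G" if "xs \<in> R_verts k" for xs
    using that
  proof induction
    case root then show ?case using u by (simp add: f_def)
  next
    case (child xs j)
    then show ?case using step[of xs] in_arcsD2 by blast
  qed
  have arc: "(f xs, f (xs @ [j])) \<in> parcs G" if "xs @ [j] \<in> R_verts k" for xs j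
    using that step[of xs] fV[of xs] R_verts_snocD[OF that] by auto
  \<comment> \<open>Two tree neighbors of \<open>b\<close> are siblings, separated by the chosen
    injection, or a child and the parent, whose image is avoided.\<close>
  have local_inj: "f a \<noteq> f c"
    if abc: "a \<in> R_verts k" "b \<in> R_verts k" "c \<in> R_verts k" "R_adj a b" "R_adj b c" "a \<noteq> c" for a b c
  proof -
    have up: "f (b @ [j]) \<noteq> f b'" if "b @ [j] \<in> R_verts k" "b = b' @ [i]" for j b' i
      using that step[of b] fV[of b] R_verts_snocD[OF that(1)] by (auto simp: par_def)
    have down: "f (b @ [j]) \<noteq> f (b @ [i])" if "b @ [j] \<in> R_verts k" "b @ [i] \<in> R_verts k" "i \<noteq> j" for i j
      using that step[of b] fV[of b] R_verts_snocD[OF that(1)] R_verts_snocD[OF that(2)]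
      by (auto dest: inj_onD)
    consider i where "b = a @ [i]" | i where "a = b @ [i]" using abc by (auto simp: R_adj_def)
    then show ?thesis
    proof cases
      case 1
      then obtain j where "c = b @ [j]" using abc by (auto simp: R_adj_def)
      then show ?thesis using up 1 abc by metis
    next
      case 2
      then consider j where "c = b @ [j]" | j where "b = c @ [j]" using abc by (auto simp: R_adj_def)
      then show ?thesis
        using 2 abc up down by cases metis+
    qed
  qed
  have "inj_on f (R_verts k)"
  proof (rule inj_onI, rule ccontr)
    fix xs ys assume xy: "xs \<in> R_verts k" "ys \<in> R_verts k" "f xs = f ys" "xs \<noteq> ys"
    \<comment> \<open>The tree path between two vertices with the same image maps to a
      non-backtracking walk with at most \<open>2 * k + 1\<close> vertices. Such a walk is a path,
      so its ends differ.\<close>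
    obtain P where P: "P \<noteq> []" "hd P = xs" "last P = ys" "set P \<subseteq> R_verts k" "distinct P"
      "successively R_adj P" "length P + 2 * 0 \<le> length xs + length ys + 1"
      using R_path_exists[OF xy(1,2), of 0] by auto
    have "length P \<le> 2 * k + 2"
      using P(7) R_verts_length_le(1)[OF xy(1) assms(1)] R_verts_length_le(1)[OF xy(2) assms(1)] by simp
    then have "enat (length (map f P)) \<le> enat (2 * k + 2)" by simp
    then have "enat (length (map f P)) \<le> girth G" using girth by (rule order_trans)
    moreover have "walk G (map f P)" unfolding successively_map
      using P(6) by (rule successively_mono) (use arc arc_sym P(4) in \<open>auto simp: R_adj_def\<close>)
    moreover have "map f P ! i \<noteq> map f P ! (i + 2)" if "i + 2 < length (map f P)" for i
    proof -
      have "R_adj (P ! i) (P ! Suc i)" "R_adj (P ! Suc i) (P ! (i + 2))"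
        using P(6) that by (auto simp: successively_conv_nth)
      moreover have "P ! i \<noteq> P ! (i + 2)" using P(5) that by (auto simp: nth_eq_iff_index_eq)
      moreover have "{P ! i, P ! Suc i, P ! (i + 2)} \<subseteq> R_verts k" using P(4) that by auto
      ultimately show ?thesis using local_inj[of "P ! i" "P ! Suc i" "P ! (i + 2)"] that by auto
    qed
    ultimately have "distinct (map f P)" by (intro walk_distinctI)
    then have "inj_on f (set P)" by (simp add: distinct_map)
    moreover have "xs \<in> set P" "ys \<in> set P" using hd_in_set[OF P(1)] last_in_set[OF P(1)] P(2,3) by simp_all
    ultimately show False using xy(3,4) by (blast dest: inj_onD)
  qed
  with arc show thesis by (rule that)
qed

theorem theorem2:
  fixes G :: "'a pair_pre_digraph" and k :: nat
  assumes "pair_graph G" and "pverts G \<noteq> {}" and "k \<ge> 3"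
  shows "(m_star G = k - 1 \<and> girth G \<ge> enat (2 * k + 2) \<and> contains_copy G (R_tree k)
            \<longrightarrow> z_number G = k)
       \<and> (card (pverts G) \<ge> (k - 3) * 2 ^ (k - 1) + k + 2 \<and>
          m_star G = k - 1 \<and> min_degree G = k - 1 \<and> girth G \<ge> enat (2 * k + 2)
            \<longrightarrow> z_number G = k)"
proof -
  interpret pair_graph G by (rule assms(1))
  have z: "z_number G = k"
    if "m_star G = k - 1" "girth G \<ge> enat (2 * k + 2)"
      "\<And>xs j. xs @ [j] \<in> R_verts k \<Longrightarrow> (f xs, f (xs @ [j])) \<in> parcs G" "inj_on f (R_verts k)" for f
  proof -
    interpret R_embedding G k f using that assms(3) by unfold_locales auto
    show ?thesis by (rule z_number_eq)
  qed
  show ?thesis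
  proof (intro conjI impI)
    assume *: "m_star G = k - 1 \<and> girth G \<ge> enat (2 * k + 2) \<and> contains_copy G (R_tree k)"
    then obtain f where "\<And>xs j. xs @ [j] \<in> R_verts k \<Longrightarrow> (f xs, f (xs @ [j])) \<in> parcs G"
      "inj_on f (R_verts k)"
      using contains_copy_R_treeD[of G k] by blast
    then show "z_number G = k" using * by (intro z) auto
  next
    assume *: "card (pverts G) \<ge> (k - 3) * 2 ^ (k - 1) + k + 2 \<and>
      m_star G = k - 1 \<and> min_degree G = k - 1 \<and> girth G \<ge> enat (2 * k + 2)"
    have deg: "k - 1 \<le> degree G v" if "v \<in> pverts G" for v
      using * that pair_finite_verts by (metis Min_le finite_imageI imageI min_degree_def)
    \<comment> \<open>Any vertex can serve as the image of the root.\<close>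
    obtain u where u: "u \<in> pverts G" using assms(2) by blast
    obtain f where "\<And>xs j. xs @ [j] \<in> R_verts k \<Longrightarrow> (f xs, f (xs @ [j])) \<in> parcs G"
      "inj_on f (R_verts k)"
      using R_embedding_exists[OF assms(3) u deg] * by blast
    then show "z_number G = k" using * by (intro z) auto
  qed
qed

end
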